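(* Let $G$ and $H$ be two strongly connected digraphs, each of order at least $2$. Then $$\lambda_2(G\Box H)\ge \lambda_2(G)+\lambda_2(H)-1.$$
   Context: All digraphs are finite, without loops or parallel arcs. For a digraph $D$ and $S\subseteq V(D)$, an $S$-strong subgraph is a strongly connected subgraph of $D$ containing all vertices of $S$; $\lambda_S(D)$ is the maximum number of pairwise arc-disjoint $S$-strong subgraphs of $D$; and $\lambda_2(D)=\min\{\lambda_S(D): S\subseteq V(D),\ |S|=2\}$. The Cartesian product $G\Box H$ has vertex set $V(G)\times V(H)$, and $(x,x')(y,y')$ is an arc iff either $xy\in A(G)$ and $x'=y'$, or $x=y$ and $x'y'\in A(H)$. *)

theory Defs
  imports "Graph_Theory.Digraph_Component"
begin

definition cartesian_product ::
  "'a pair_pre_digraph \<Rightarrow> 'b pair_pre_digraph \<Rightarrow> ('a \<times> 'b) pair_pre_digraph"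
  (infixr \<open>\<box>\<close> 80) where
  "G \<box> H = \<lparr>
     pverts = pverts G \<times> pverts H,
     parcs = {((x, x'), (y, y')) | x x' y y'.
       (x, x') \<in> pverts G \<times> pverts H \<and> (y, y') \<in> pverts G \<times> pverts H \<and>
       ((x, y) \<in> parcs G \<and> x' = y' \<or> x = y \<and> (x', y') \<in> parcs H)} \<rparr>"

definition strong_subgraph ::
  "'a pair_pre_digraph \<Rightarrow> 'a set \<Rightarrow> 'a pair_pre_digraph \<Rightarrow> bool" where
  "strong_subgraph D S F \<longleftrightarrow>
     subgraph (with_proj F) (with_proj D) \<and> strongly_connected (with_proj F) \<and> S \<subseteq> pverts F"

definition strong_packing ::
  "'a pair_pre_digraph \<Rightarrow> 'a set \<Rightarrow> 'a pair_pre_digraph set \<Rightarrow> bool" where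
  "strong_packing D S \<F> \<longleftrightarrow>
     (\<forall>F\<in>\<F>. strong_subgraph D S F) \<and>
     pairwise (\<lambda>F F'. parcs F \<inter> parcs F' = {}) \<F>"

text \<open>
  A packing is a set of subgraphs, which loses nothing when \<open>2 \<le> card S\<close>: every \<open>S\<close>-strong
  subgraph then has an arc, so arc-disjoint members of a family are distinct.
\<close>

definition lambda_S :: "'a pair_pre_digraph \<Rightarrow> 'a set \<Rightarrow> nat" where
  "lambda_S D S = Max {card \<F> | \<F>. strong_packing D S \<F>}"

definition lambda_2 :: "'a pair_pre_digraph \<Rightarrow> nat" where
  "lambda_2 D = Min {lambda_S D S | S. S \<subseteq> pverts D \<and> card S = 2}"

lemma pair_digraph_cartesian_product:
  assumes "pair_digraph G" "pair_digraph H"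
  shows "pair_digraph (G \<box> H)"
proof -
  interpret G: pair_digraph G by fact
  interpret H: pair_digraph H by fact
  have "parcs (G \<box> H) \<subseteq> (pverts G \<times> pverts H) \<times> (pverts G \<times> pverts H)"
    by (auto simp: cartesian_product_def)
  then have "finite (parcs (G \<box> H))"
    by (rule finite_subset) (simp)
  then show ?thesis
    by unfold_locales
      (auto simp: cartesian_product_def dest: G.no_loops' H.no_loops')
qed

text \<open>The maximum and the minimum above are taken over finite nonempty sets.\<close>

lemma finite_strong_packings:
  assumes "pair_digraph D"
  shows "finite {\<F>. strong_packing D S \<F>}"
proof -
  interpret pair_digraph D by fact
  let ?A = "(\<lambda>(V, A). \<lparr>pverts = V, parcs = A\<rparr>) ` (Pow (pverts D) \<times> Pow (parcs D))"
  have "F \<in> ?A" if "strong_subgraph D S F" for F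
    using that by (cases F) (auto simp: strong_subgraph_def subgraph_def image_iff)
  then have "{\<F>. strong_packing D S \<F>} \<subseteq> Pow ?A"
    unfolding strong_packing_def by blast
  moreover have "finite (Pow ?A)"
    by simp
  ultimately show ?thesis
    by (rule finite_subset)
qed

lemma finite_packing_sizes:
  assumes "pair_digraph D"
  shows "finite {card \<F> | \<F>. strong_packing D S \<F>}"
  unfolding setcompr_eq_image by (rule finite_imageI[OF finite_strong_packings[OF assms]])

lemma packing_sizes_nonempty: "{card \<F> | \<F>. strong_packing D S \<F>} \<noteq> {}"
proof -
  have "strong_packing D S {}"
    by (simp add: strong_packing_def)
  then show ?thesis
    by blast
qed

lemma finite_lambda_S_values:
  assumes "pair_digraph D"
  shows "finite {lambda_S D S | S. S \<subseteq> pverts D \<and> card S = 2}"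
proof -
  interpret pair_digraph D by fact
  show ?thesis
    by (rule finite_subset[of _ "lambda_S D ` Pow (pverts D)"]) auto
qed

lemma lambda_S_values_nonempty:
  assumes "2 \<le> card (pverts D)"
  shows "{lambda_S D S | S. S \<subseteq> pverts D \<and> card S = 2} \<noteq> {}"
proof -
  obtain S where "S \<subseteq> pverts D" "card S = 2"
    using obtain_subset_with_card_n[OF assms] by metis
  then show ?thesis
    by blast
qed

end

theory Submission
  imports Defs
begin

text \<open>
  Let \<open>(x, c)\<close> and \<open>(y, d)\<close> be distinct vertices of \<open>G \<box> H\<close>. Choose pairs of vertices \<open>S\<close> of \<open>G\<close>
  and \<open>T\<close> of \<open>H\<close> with \<open>x, y \<in> S\<close> and \<open>c, d \<in> T\<close>, a largest \<open>S\<close>-strong packing of \<open>G\<close> and a largest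
  \<open>T\<close>-strong packing of \<open>H\<close>. The members \<open>F\<close> of the first leave \<open>x\<close> towards pairwise distinct
  vertices \<open>u F\<close>, and \<open>u F = y\<close> for at most one of them, \<open>F\<^sub>0\<close>; likewise the members \<open>K\<close> of the
  second leave \<open>c\<close> towards vertices \<open>v K\<close>, with one exception \<open>K\<^sub>0\<close>. Every \<open>F \<noteq> F\<^sub>0\<close> gives a
  subgraph of \<open>G \<box> H\<close> formed by the copies of \<open>F\<close> in the rows \<open>c\<close> and \<open>d\<close>, linked by the whole
  column \<open>u F\<close>; every \<open>K \<noteq> K\<^sub>0\<close> gives the transposed subgraph; and \<open>F\<^sub>0\<close> in row \<open>c\<close> together with
  \<open>K\<^sub>0\<close> in column \<open>y\<close> gives one more. All of these contain both vertices and are arc-disjoint, also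
  when \<open>x = y\<close> or \<open>c = d\<close>.
\<close>

section \<open>Unions and Cartesian products of strong subgraphs\<close>

definition pair_union ::
  "'a pair_pre_digraph \<Rightarrow> 'a pair_pre_digraph \<Rightarrow> 'a pair_pre_digraph" (infixl \<open>\<squnion>\<close> 65) where
  "F \<squnion> K = \<lparr>pverts = pverts F \<union> pverts K, parcs = parcs F \<union> parcs K\<rparr>"

definition point :: "'a \<Rightarrow> 'a pair_pre_digraph" where
  "point v = \<lparr>pverts = {v}, parcs = {}\<rparr>"

abbreviation arc_disjoint :: "'a pair_pre_digraph \<Rightarrow> 'a pair_pre_digraph \<Rightarrow> bool" where
  "arc_disjoint F K \<equiv> parcs F \<inter> parcs K = {}"

lemma pair_union_simps [simp]:
  "pverts (F \<squnion> K) = pverts F \<union> pverts K"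
  "parcs (F \<squnion> K) = parcs F \<union> parcs K"
  by (simp_all add: pair_union_def)

lemma point_simps [simp]:
  "pverts (point v) = {v}"
  "parcs (point v) = {}"
  by (simp_all add: point_def)

lemma pverts_cartesian_product [simp]: "pverts (G \<box> H) = pverts G \<times> pverts H"
  by (simp add: cartesian_product_def)

lemma pair_wf_digraph_cartesian_product: "pair_wf_digraph (G \<box> H)"
  by unfold_locales (auto simp: cartesian_product_def)

lemma strongly_connected_cartesian_product:
  assumes "pair_wf_digraph G" "pair_wf_digraph H"
    and "strongly_connected (with_proj G)" "strongly_connected (with_proj H)"
  shows "strongly_connected (with_proj (G \<box> H))"
proof
  interpret G: pair_wf_digraph G by fact
  interpret H: pair_wf_digraph H by fact
  interpret GH: pair_wf_digraph "G \<box> H" by (rule pair_wf_digraph_cartesian_product)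
  show "verts (with_proj (G \<box> H)) \<noteq> {}"
    using assms(3,4) by (simp add: strongly_connected_def)
  fix p q
  assume p: "p \<in> verts (with_proj (G \<box> H))" and q: "q \<in> verts (with_proj (G \<box> H))"
  obtain x c y d where pq: "p = (x, c)" "q = (y, d)"
    by (metis surj_pair)
  have "x \<rightarrow>\<^sup>*\<^bsub>with_proj G\<^esub> y" "c \<in> pverts H"
    using p q pq assms(3) by auto
  then have "(x, c) \<rightarrow>\<^sup>*\<^bsub>with_proj (G \<box> H)\<^esub> (y, c)"
  proof (induction rule: G.reachable_induct)
    case (step u v)
    then have "((u, c), (v, c)) \<in> parcs (G \<box> H)"
      by (auto simp: cartesian_product_def dest: G.wellformed')
    with step.IH[OF step.prems] show ?case
      by (rule GH.reachable_adj_trans)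
  qed simp
  moreover have "c \<rightarrow>\<^sup>*\<^bsub>with_proj H\<^esub> d" "y \<in> pverts G"
    using p q pq assms(4) by auto
  then have "(y, c) \<rightarrow>\<^sup>*\<^bsub>with_proj (G \<box> H)\<^esub> (y, d)"
  proof (induction rule: H.reachable_induct)
    case (step u v)
    then have "((y, u), (y, v)) \<in> parcs (G \<box> H)"
      by (auto simp: cartesian_product_def dest: H.wellformed')
    with step.IH[OF step.prems] show ?case
      by (rule GH.reachable_adj_trans)
  qed simp
  ultimately show "p \<rightarrow>\<^sup>*\<^bsub>with_proj (G \<box> H)\<^esub> q"
    unfolding pq by (rule GH.reachable_trans)
qed

locale strong_digraph = pair_digraph +
  assumes strongly_connected: "strongly_connected (with_proj G)"

lemma strong_subgraph_antimono:
  "strong_subgraph D S F \<Longrightarrow> S' \<subseteq> S \<Longrightarrow> strong_subgraph D S' F"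
  by (auto simp: strong_subgraph_def)

lemma strong_subgraph_insert:
  "strong_subgraph D S F \<Longrightarrow> v \<in> pverts F \<Longrightarrow> strong_subgraph D (insert v S) F"
  by (simp add: strong_subgraph_def)

lemma strong_subgraphD:
  assumes "strong_subgraph D S F"
  shows "pair_wf_digraph F" "pverts F \<subseteq> pverts D" "parcs F \<subseteq> parcs D"
    and "strongly_connected (with_proj F)" "S \<subseteq> pverts F"
  using assms by (simp_all add: strong_subgraph_def subgraph_def wf_digraph_wp_iff)

lemma (in strong_digraph) strong_subgraph_refl: "S \<subseteq> pverts G \<Longrightarrow> strong_subgraph G S G"
  by (simp add: strong_subgraph_def subgraph_refl strongly_connected)

lemma (in pair_wf_digraph) strong_subgraph_point:
  assumes "v \<in> pverts G"
  shows "strong_subgraph G {v} (point v)"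
proof -
  interpret point: pair_wf_digraph "point v"
    by unfold_locales auto
  have "subgraph (with_proj (point v)) (with_proj G)"
    using assms point.wf_digraph wf_digraph by (intro subgraphI) auto
  moreover have "strongly_connected (with_proj (point v))"
    by auto
  ultimately show ?thesis
    by (simp add: strong_subgraph_def)
qed

lemma strong_subgraph_union:
  assumes F: "strong_subgraph D S F" and K: "strong_subgraph D T K" and "S \<inter> T \<noteq> {}"
  shows "strong_subgraph D (S \<union> T) (F \<squnion> K)"
proof -
  have union: "with_proj (F \<squnion> K) = union (with_proj F) (with_proj K)"
    by (simp add: union_def with_proj_def)
  have "subgraph (with_proj (F \<squnion> K)) (with_proj D)"
    using F K unfolding union strong_subgraph_def by auto
  moreover have "strongly_connected (with_proj (F \<squnion> K))"
    unfolding union using assms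
    by (intro strongly_connected_non_disj) (auto simp: strong_subgraph_def)
  ultimately show ?thesis
    using F K by (auto simp: strong_subgraph_def)
qed

lemma strong_subgraph_product:
  assumes F: "strong_subgraph G S F" and K: "strong_subgraph H T K"
  shows "strong_subgraph (G \<box> H) (S \<times> T) (F \<box> K)"
proof -
  note F = strong_subgraphD[OF F]
  note K = strong_subgraphD[OF K]
  have "parcs (F \<box> K) \<subseteq> parcs (G \<box> H)"
    using F(2,3) K(2,3) by (auto simp: cartesian_product_def)
  then have "subgraph (with_proj (F \<box> K)) (with_proj (G \<box> H))"
    using F(2) K(2)
    by (intro subgraphI) (auto simp: wf_digraph_wp_iff intro: pair_wf_digraph_cartesian_product)
  moreover have "strongly_connected (with_proj (F \<box> K))"
    using F(1,4) K(1,4) by (intro strongly_connected_cartesian_product)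
  ultimately show ?thesis
    using F(5) K(5) by (auto simp: strong_subgraph_def)
qed

lemma strong_subgraph_out_arc:
  assumes F: "strong_subgraph D S F" and "x \<in> S" "S \<noteq> {x}"
  obtains u where "(x, u) \<in> parcs F" "u \<in> pverts F"
proof -
  obtain y where "y \<in> S" "x \<noteq> y"
    using \<open>x \<in> S\<close> \<open>S \<noteq> {x}\<close> by blast
  have "x \<rightarrow>\<^sup>*\<^bsub>with_proj F\<^esub> y"
    using strong_subgraphD(4,5)[OF F] \<open>x \<in> S\<close> \<open>y \<in> S\<close> by (auto simp: strongly_connected_def)
  then obtain u where "(x, u) \<in> parcs F"
    using \<open>x \<noteq> y\<close> by (cases rule: pre_digraph.converse_reachable_cases) auto
  then show ?thesis
    using that pair_wf_digraph.in_arcsD2[OF strong_subgraphD(1)[OF F]] by blast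
qed

section \<open>Strong packings\<close>

lemma strong_packing_subset:
  "strong_packing D S \<F> \<Longrightarrow> \<F>' \<subseteq> \<F> \<Longrightarrow> strong_packing D S \<F>'"
  by (auto simp: strong_packing_def intro: pairwise_subset)

lemma strong_packing_strong_subgraph:
  "strong_packing D S \<F> \<Longrightarrow> F \<in> \<F> \<Longrightarrow> strong_subgraph D S F"
  by (simp add: strong_packing_def)

lemma strong_packing_arc_disjoint:
  "strong_packing D S \<F> \<Longrightarrow> F \<in> \<F> \<Longrightarrow> F' \<in> \<F> \<Longrightarrow> F \<noteq> F' \<Longrightarrow> arc_disjoint F F'"
  by (simp add: strong_packing_def pairwise_def)

lemma strong_packing_image:
  assumes strong: "\<And>i. i \<in> I \<Longrightarrow> strong_subgraph D S (F i)"
    and disjoint: "\<And>i j. i \<in> I \<Longrightarrow> j \<in> I \<Longrightarrow> i \<noteq> j \<Longrightarrow> arc_disjoint (F i) (F j)"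
    and S: "x \<in> S" "S \<noteq> {x}"
  shows "strong_packing D S (F ` I)" "card (F ` I) = card I"
proof -
  show "strong_packing D S (F ` I)"
    using strong disjoint unfolding strong_packing_def by (force intro: pairwise_imageI)
  have "parcs (F i) \<noteq> {}" if "i \<in> I" for i
    using strong_subgraph_out_arc[OF strong[OF that] S] by blast
  then have "inj_on F I"
    using disjoint by (metis inf.idem inj_onI)
  then show "card (F ` I) = card I"
    by (rule card_image)
qed

definition distinct_representatives ::
  "'a pair_pre_digraph set \<Rightarrow> 'a set \<Rightarrow> ('a pair_pre_digraph \<Rightarrow> 'a) \<Rightarrow> bool" where
  "distinct_representatives \<F> A u \<longleftrightarrow> inj_on u \<F> \<and> (\<forall>F\<in>\<F>. u F \<in> pverts F - A)"

lemma strong_packing_image_representatives: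
  assumes \<F>: "strong_packing D S \<F>" and u: "distinct_representatives \<F> A u"
    and strong: "\<And>F w. strong_subgraph D S F \<Longrightarrow> w \<in> pverts F \<Longrightarrow> strong_subgraph D' P (f w F)"
    and disjoint: "\<And>F F' w w'. strong_subgraph D S F \<Longrightarrow> strong_subgraph D S F' \<Longrightarrow>
      arc_disjoint F F' \<Longrightarrow> w \<noteq> w' \<Longrightarrow> arc_disjoint (f w F) (f w' F')"
    and P: "p \<in> P" "P \<noteq> {p}"
  shows "strong_packing D' P ((\<lambda>F. f (u F) F) ` \<F>)" "card ((\<lambda>F. f (u F) F) ` \<F>) = card \<F>"
proof -
  note \<F>_strong = strong_packing_strong_subgraph[OF \<F>]
  have "strong_subgraph D' P (f (u F) F)" if "F \<in> \<F>" for F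
    using strong[OF \<F>_strong[OF that]] u that by (simp add: distinct_representatives_def)
  moreover have "arc_disjoint (f (u F) F) (f (u F') F')" if "F \<in> \<F>" "F' \<in> \<F>" "F \<noteq> F'" for F F'
  proof (intro disjoint \<F>_strong strong_packing_arc_disjoint[OF \<F>] that)
    show "u F \<noteq> u F'"
      using u that by (auto simp: distinct_representatives_def dest: inj_onD)
  qed
  ultimately show "strong_packing D' P ((\<lambda>F. f (u F) F) ` \<F>)"
    "card ((\<lambda>F. f (u F) F) ` \<F>) = card \<F>"
    using strong_packing_image[OF _ _ P, of \<F> D' "\<lambda>F. f (u F) F"] by blast+
qed

context pair_digraph
begin

lemma finite_strong_packing:
  assumes "strong_packing G S \<F>"
  shows "finite \<F>"
proof -
  have "Pow \<F> \<subseteq> {\<F>'. strong_packing G S \<F>'}"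
    using strong_packing_subset[OF assms] by auto
  then show ?thesis
    using finite_strong_packings[OF pair_digraph] by (metis finite_Pow_iff finite_subset)
qed

lemma strong_packing_Un:
  assumes \<F>: "strong_packing G S \<F>" and \<K>: "strong_packing G S \<K>"
    and disjoint: "\<And>F K. F \<in> \<F> \<Longrightarrow> K \<in> \<K> \<Longrightarrow> arc_disjoint F K"
    and S: "x \<in> S" "S \<noteq> {x}"
  shows "strong_packing G S (\<F> \<union> \<K>)" and "card (\<F> \<union> \<K>) = card \<F> + card \<K>"
proof -
  show "strong_packing G S (\<F> \<union> \<K>)"
    using \<F> \<K> disjoint unfolding strong_packing_def pairwise_def by blast
  have "parcs F \<noteq> {}" if "F \<in> \<F>" for F
    using strong_subgraph_out_arc[OF strong_packing_strong_subgraph[OF \<F> that] S] by blast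
  then have "\<F> \<inter> \<K> = {}"
    using disjoint by fastforce
  then show "card (\<F> \<union> \<K>) = card \<F> + card \<K>"
    using finite_strong_packing[OF \<F>] finite_strong_packing[OF \<K>] by (intro card_Un_disjoint)
qed

lemma card_strong_packing_le_lambda_S:
  "strong_packing G S \<F> \<Longrightarrow> card \<F> \<le> lambda_S G S"
  unfolding lambda_S_def using finite_packing_sizes[OF pair_digraph] by (intro Max_ge) auto

lemma strong_packing_insert:
  assumes \<F>: "strong_packing G S \<F>" and F: "strong_subgraph G S F"
    and disjoint: "\<And>K. K \<in> \<F> \<Longrightarrow> arc_disjoint F K"
    and S: "x \<in> S" "S \<noteq> {x}"
  shows "strong_packing G S (insert F \<F>)" and "card (insert F \<F>) = Suc (card \<F>)"
proof -
  have "strong_packing G S {F}"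
    using F by (simp add: strong_packing_def)
  from strong_packing_Un[OF this \<F> _ S] disjoint
  show "strong_packing G S (insert F \<F>)" and "card (insert F \<F>) = Suc (card \<F>)"
    by auto
qed

lemma obtain_maximum_strong_packing:
  obtains \<F> where "strong_packing G S \<F>" "card \<F> = lambda_S G S"
proof -
  have "lambda_S G S \<in> {card \<F> | \<F>. strong_packing G S \<F>}"
    unfolding lambda_S_def
    using finite_packing_sizes[OF pair_digraph] packing_sizes_nonempty by (rule Max_in)
  then show ?thesis
    using that by auto
qed

lemma lambda_2_le_lambda_S:
  "S \<subseteq> pverts G \<Longrightarrow> card S = 2 \<Longrightarrow> lambda_2 G \<le> lambda_S G S"
  unfolding lambda_2_def using finite_lambda_S_values[OF pair_digraph] by (intro Min_le) auto

lemma obtain_pair_attaining_lambda_2: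
  assumes "2 \<le> card (pverts G)"
  obtains p q where "p \<in> pverts G" "q \<in> pverts G" "p \<noteq> q" "lambda_2 G = lambda_S G {p, q}"
proof -
  have "lambda_2 G \<in> {lambda_S G S | S. S \<subseteq> pverts G \<and> card S = 2}"
    unfolding lambda_2_def
    using finite_lambda_S_values[OF pair_digraph] lambda_S_values_nonempty[OF assms]
    by (rule Min_in)
  then show ?thesis
    using that by (auto simp: card_2_iff)
qed

lemma obtain_pair_containing:
  assumes "2 \<le> card (pverts G)" "x \<in> pverts G" "y \<in> pverts G"
  obtains S where "{x, y} \<subseteq> S" "S \<subseteq> pverts G" "card S = 2"
proof -
  have "card {x, y} \<le> 2"
    by (simp add: card_insert_if)
  then show ?thesis
    using that exists_subset_between[of "{x, y}" 2 "pverts G"] assms pair_finite_verts by auto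
qed

lemma obtain_distinct_out_neighbours:
  assumes \<F>: "strong_packing G S \<F>" and S: "x \<in> S" "S \<noteq> {x}"
  obtains u where "inj_on u \<F>" "\<And>F. F \<in> \<F> \<Longrightarrow> u F \<in> pverts F \<and> u F \<noteq> x"
proof -
  have "\<exists>u. (x, u) \<in> parcs F \<and> u \<in> pverts F" if "F \<in> \<F>" for F
    using strong_subgraph_out_arc[OF strong_packing_strong_subgraph[OF \<F> that] S] by blast
  then obtain u where u: "\<And>F. F \<in> \<F> \<Longrightarrow> (x, u F) \<in> parcs F \<and> u F \<in> pverts F"
    by metis
  have "inj_on u \<F>"
    using u strong_packing_arc_disjoint[OF \<F>] by (intro inj_onI) (metis disjoint_iff)
  moreover have "u F \<noteq> x" if "F \<in> \<F>" for F
    using u[OF that] no_loops'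
      strong_subgraphD(3)[OF strong_packing_strong_subgraph[OF \<F> that]] by blast
  ultimately show ?thesis
    using that u by blast
qed

lemma obtain_distinct_representatives_avoiding:
  assumes "strong_packing G S \<F>" "\<F> \<noteq> {}" "x \<in> S" "S \<noteq> {x}"
  obtains F\<^sub>0 u where "F\<^sub>0 \<in> \<F>" "distinct_representatives (\<F> - {F\<^sub>0}) {x, y} u"
proof -
  obtain u where u: "inj_on u \<F>" "\<And>F. F \<in> \<F> \<Longrightarrow> u F \<in> pverts F \<and> u F \<noteq> x"
    using obtain_distinct_out_neighbours[OF assms(1,3,4)] by blast
  obtain F\<^sub>0 where F\<^sub>0: "F\<^sub>0 \<in> \<F>" "\<And>F. F \<in> \<F> - {F\<^sub>0} \<Longrightarrow> u F \<noteq> y"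
  proof (cases "y \<in> u ` \<F>")
    case True
    then show ?thesis
      using that u(1) by (metis DiffE image_iff inj_onD singletonI)
  next
    case False
    then show ?thesis
      using that \<open>\<F> \<noteq> {}\<close> by blast
  qed
  have "distinct_representatives (\<F> - {F\<^sub>0}) {x, y} u"
    using F\<^sub>0(2) u inj_on_subset[OF u(1)] by (auto simp: distinct_representatives_def)
  with \<open>F\<^sub>0 \<in> \<F>\<close> show ?thesis
    by (rule that)
qed

end

lemma (in strong_digraph) lambda_S_pos:
  assumes "S \<subseteq> pverts G"
  shows "0 < lambda_S G S"
proof -
  have "strong_packing G S {G}"
    using strong_subgraph_refl[OF assms] by (simp add: strong_packing_def)
  then show ?thesis
    using card_strong_packing_le_lambda_S by fastforce
qed

section \<open>Ladders in a Cartesian product\<close>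

definition row_ladder ::
  "'b pair_pre_digraph \<Rightarrow> 'b \<Rightarrow> 'b \<Rightarrow> 'a \<Rightarrow> 'a pair_pre_digraph \<Rightarrow> ('a \<times> 'b) pair_pre_digraph" where
  "row_ladder H c d u F = F \<box> point c \<squnion> point u \<box> H \<squnion> F \<box> point d"

definition column_ladder ::
  "'a pair_pre_digraph \<Rightarrow> 'a \<Rightarrow> 'a \<Rightarrow> 'b \<Rightarrow> 'b pair_pre_digraph \<Rightarrow> ('a \<times> 'b) pair_pre_digraph" where
  "column_ladder G x y v K = point x \<box> K \<squnion> G \<box> point v \<squnion> point y \<box> K"

definition corner ::
  "'b \<Rightarrow> 'a \<Rightarrow> 'a pair_pre_digraph \<Rightarrow> 'b pair_pre_digraph \<Rightarrow> ('a \<times> 'b) pair_pre_digraph" where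
  "corner c y F K = F \<box> point c \<squnion> point y \<box> K"

abbreviation row_ladders ::
  "'b pair_pre_digraph \<Rightarrow> 'b \<Rightarrow> 'b \<Rightarrow> ('a pair_pre_digraph \<Rightarrow> 'a) \<Rightarrow> 'a pair_pre_digraph set \<Rightarrow>
    ('a \<times> 'b) pair_pre_digraph set" where
  "row_ladders H c d u \<F> \<equiv> (\<lambda>F. row_ladder H c d (u F) F) ` \<F>"

abbreviation column_ladders ::
  "'a pair_pre_digraph \<Rightarrow> 'a \<Rightarrow> 'a \<Rightarrow> ('b pair_pre_digraph \<Rightarrow> 'b) \<Rightarrow> 'b pair_pre_digraph set \<Rightarrow>
    ('a \<times> 'b) pair_pre_digraph set" where
  "column_ladders G x y v \<K> \<equiv> (\<lambda>K. column_ladder G x y (v K) K) ` \<K>"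

lemma arc_disjoint_rows:
  "c \<noteq> d \<or> arc_disjoint F F' \<Longrightarrow> arc_disjoint (F \<box> point c) (F' \<box> point d)"
  by (auto simp: cartesian_product_def)

lemma arc_disjoint_columns:
  "x \<noteq> y \<or> arc_disjoint K K' \<Longrightarrow> arc_disjoint (point x \<box> K) (point y \<box> K')"
  by (auto simp: cartesian_product_def)

lemma (in pair_loopfree_digraph) arc_disjoint_row_column:
  assumes "parcs F \<subseteq> parcs G"
  shows "arc_disjoint (F \<box> point c) (point x \<box> K)" "arc_disjoint (point x \<box> K) (F \<box> point c)"
  using assms no_loops' by (auto simp: cartesian_product_def)

locale strong_digraph_pair =
  G: strong_digraph G + H: strong_digraph H
  for G :: "'a pair_pre_digraph" and H :: "'b pair_pre_digraph"
begin

sublocale product: strong_digraph "G \<box> H"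
  unfolding strong_digraph_def strong_digraph_axioms_def
  by (auto intro: pair_digraph_cartesian_product strongly_connected_cartesian_product
      G.strongly_connected H.strongly_connected)

lemma strong_subgraph_row:
  "strong_subgraph G S F \<Longrightarrow> c \<in> pverts H \<Longrightarrow> strong_subgraph (G \<box> H) (S \<times> {c}) (F \<box> point c)"
  by (intro strong_subgraph_product H.strong_subgraph_point)

lemma strong_subgraph_column:
  "strong_subgraph H T K \<Longrightarrow> x \<in> pverts G \<Longrightarrow> strong_subgraph (G \<box> H) ({x} \<times> T) (point x \<box> K)"
  by (intro strong_subgraph_product G.strong_subgraph_point)

lemma strong_subgraph_row_ladder:
  assumes F: "strong_subgraph G S F" and u: "u \<in> pverts F" and cd: "c \<in> pverts H" "d \<in> pverts H"
  shows "strong_subgraph (G \<box> H) (S \<times> {c, d}) (row_ladder H c d u F)"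
proof -
  have row: "strong_subgraph (G \<box> H) (insert u S \<times> {a}) (F \<box> point a)" if "a \<in> pverts H" for a
    using strong_subgraph_insert[OF F u] that by (rule strong_subgraph_row)
  have "u \<in> pverts G"
    using strong_subgraphD(2)[OF F] u by blast
  then have column: "strong_subgraph (G \<box> H) ({u} \<times> {c, d}) (point u \<box> H)"
    using cd by (intro strong_subgraph_column H.strong_subgraph_refl) auto
  have "strong_subgraph (G \<box> H) (insert u S \<times> {c} \<union> {u} \<times> {c, d} \<union> insert u S \<times> {d})
      (row_ladder H c d u F)"
    unfolding row_ladder_def by (intro strong_subgraph_union row column cd) auto
  then show ?thesis
    by (rule strong_subgraph_antimono) auto
qed

lemma strong_subgraph_column_ladder:
  assumes K: "strong_subgraph H T K" and v: "v \<in> pverts K" and xy: "x \<in> pverts G" "y \<in> pverts G"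
  shows "strong_subgraph (G \<box> H) ({x, y} \<times> T) (column_ladder G x y v K)"
proof -
  have column: "strong_subgraph (G \<box> H) ({a} \<times> insert v T) (point a \<box> K)" if "a \<in> pverts G" for a
    using strong_subgraph_insert[OF K v] that by (rule strong_subgraph_column)
  have "v \<in> pverts H"
    using strong_subgraphD(2)[OF K] v by blast
  then have row: "strong_subgraph (G \<box> H) ({x, y} \<times> {v}) (G \<box> point v)"
    using xy by (intro strong_subgraph_row G.strong_subgraph_refl) auto
  have "strong_subgraph (G \<box> H) ({x} \<times> insert v T \<union> {x, y} \<times> {v} \<union> {y} \<times> insert v T)
      (column_ladder G x y v K)"
    unfolding column_ladder_def by (intro strong_subgraph_union row column xy) auto
  then show ?thesis
    by (rule strong_subgraph_antimono) auto
qed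

lemma strong_subgraph_corner:
  assumes F: "strong_subgraph G S F" and K: "strong_subgraph H T K" and "y \<in> S" "c \<in> T"
  shows "strong_subgraph (G \<box> H) (S \<times> {c} \<union> {y} \<times> T) (corner c y F K)"
proof -
  have "y \<in> pverts G" "c \<in> pverts H"
    using assms strong_subgraphD(2,5)[OF F] strong_subgraphD(2,5)[OF K] by auto
  then show ?thesis
    unfolding corner_def using assms
    by (intro strong_subgraph_union strong_subgraph_row strong_subgraph_column) auto
qed

lemmas arc_disjointness = Int_Un_distrib Int_Un_distrib2
  arc_disjoint_rows arc_disjoint_columns G.arc_disjoint_row_column

lemma arc_disjoint_row_ladders:
  assumes "parcs F \<subseteq> parcs G" "parcs F' \<subseteq> parcs G" "arc_disjoint F F'" "u \<noteq> u'"
  shows "arc_disjoint (row_ladder H c d u F) (row_ladder H c d u' F')"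
  using assms by (simp add: row_ladder_def arc_disjointness)

lemma arc_disjoint_column_ladders:
  assumes "arc_disjoint K K'" "v \<noteq> v'"
  shows "arc_disjoint (column_ladder G x y v K) (column_ladder G x y v' K')"
  using assms by (simp add: column_ladder_def arc_disjointness)

lemma arc_disjoint_row_ladder_column_ladder:
  assumes "parcs F \<subseteq> parcs G" "u \<noteq> x" "u \<noteq> y" "c \<noteq> v" "d \<noteq> v"
  shows "arc_disjoint (row_ladder H c d u F) (column_ladder G x y v K)"
  using assms by (simp add: row_ladder_def column_ladder_def arc_disjointness)

lemma arc_disjoint_corner_row_ladder:
  assumes "parcs F \<subseteq> parcs G" "parcs F' \<subseteq> parcs G" "arc_disjoint F F'" "y \<noteq> u"
  shows "arc_disjoint (corner c y F K) (row_ladder H c d u F')"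
  using assms by (simp add: corner_def row_ladder_def arc_disjointness)

lemma arc_disjoint_corner_column_ladder:
  assumes "parcs F \<subseteq> parcs G" "arc_disjoint K K'" "c \<noteq> v"
  shows "arc_disjoint (corner c y F K) (column_ladder G x y v K')"
  using assms by (simp add: corner_def column_ladder_def arc_disjointness)

lemma row_ladders_strong_packing:
  assumes \<F>: "strong_packing G S \<F>" and xy: "x \<in> S" "y \<in> S"
    and cd: "c \<in> pverts H" "d \<in> pverts H" and neq: "(x, c) \<noteq> (y, d)"
    and u: "distinct_representatives \<F> A u"
  shows "strong_packing (G \<box> H) {(x, c), (y, d)} (row_ladders H c d u \<F>)" (is ?packing)
    and "card (row_ladders H c d u \<F>) = card \<F>" (is ?card)
proof -
  have strong: "strong_subgraph (G \<box> H) {(x, c), (y, d)} (row_ladder H c d w F)"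
    if "strong_subgraph G S F" "w \<in> pverts F" for F w
    using strong_subgraph_row_ladder[OF that cd]
    by (rule strong_subgraph_antimono) (use xy in auto)
  have disjoint: "arc_disjoint (row_ladder H c d w F) (row_ladder H c d w' F')"
    if "strong_subgraph G S F" "strong_subgraph G S F'" "arc_disjoint F F'" "w \<noteq> w'" for F F' w w'
    using strong_subgraphD(3)[OF that(1)] strong_subgraphD(3)[OF that(2)] that(3,4)
    by (rule arc_disjoint_row_ladders)
  have P: "(x, c) \<in> {(x, c), (y, d)}" "{(x, c), (y, d)} \<noteq> {(x, c)}"
    using neq by auto
  show ?packing
    using \<F> u strong disjoint P by (rule strong_packing_image_representatives)
  show ?card
    using \<F> u strong disjoint P by (rule strong_packing_image_representatives)
qed

lemma column_ladders_strong_packing: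
  assumes \<K>: "strong_packing H T \<K>" and cd: "c \<in> T" "d \<in> T"
    and xy: "x \<in> pverts G" "y \<in> pverts G" and neq: "(x, c) \<noteq> (y, d)"
    and v: "distinct_representatives \<K> A v"
  shows "strong_packing (G \<box> H) {(x, c), (y, d)} (column_ladders G x y v \<K>)" (is ?packing)
    and "card (column_ladders G x y v \<K>) = card \<K>" (is ?card)
proof -
  have strong: "strong_subgraph (G \<box> H) {(x, c), (y, d)} (column_ladder G x y w K)"
    if "strong_subgraph H T K" "w \<in> pverts K" for K w
    using strong_subgraph_column_ladder[OF that xy]
    by (rule strong_subgraph_antimono) (use cd in auto)
  have P: "(x, c) \<in> {(x, c), (y, d)}" "{(x, c), (y, d)} \<noteq> {(x, c)}"
    using neq by auto
  show ?packing
    using \<K> v strong arc_disjoint_column_ladders P by (rule strong_packing_image_representatives)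
  show ?card
    using \<K> v strong arc_disjoint_column_ladders P by (rule strong_packing_image_representatives)
qed

lemma ladders_strong_packing:
  assumes \<F>: "strong_packing G S \<F>" and S: "S \<subseteq> pverts G" "x \<in> S" "y \<in> S"
    and \<K>: "strong_packing H T \<K>" and T: "T \<subseteq> pverts H" "c \<in> T" "d \<in> T"
    and neq: "(x, c) \<noteq> (y, d)"
    and u: "distinct_representatives \<F> {x, y} u" and v: "distinct_representatives \<K> {c, d} v"
  shows "strong_packing (G \<box> H) {(x, c), (y, d)}
      (row_ladders H c d u \<F> \<union> column_ladders G x y v \<K>)" (is ?packing)
    and "card (row_ladders H c d u \<F> \<union> column_ladders G x y v \<K>) = card \<F> + card \<K>" (is ?card)
proof -
  have xy: "x \<in> pverts G" "y \<in> pverts G" and cd: "c \<in> pverts H" "d \<in> pverts H"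
    using S T by auto
  have P: "(x, c) \<in> {(x, c), (y, d)}" "{(x, c), (y, d)} \<noteq> {(x, c)}"
    using neq by auto
  note rows = row_ladders_strong_packing[OF \<F> S(2,3) cd neq u]
  note columns = column_ladders_strong_packing[OF \<K> T(2,3) xy neq v]
  have "arc_disjoint (row_ladder H c d (u F) F) (column_ladder G x y (v K) K)"
    if "F \<in> \<F>" "K \<in> \<K>" for F K
    using that u v strong_subgraphD(3)[OF strong_packing_strong_subgraph[OF \<F> that(1)]]
    by (intro arc_disjoint_row_ladder_column_ladder) (auto simp: distinct_representatives_def)
  then have disjoint: "arc_disjoint R C"
    if "R \<in> row_ladders H c d u \<F>" "C \<in> column_ladders G x y v \<K>" for R C
    using that by blast
  show ?packing
    using rows(1) columns(1) disjoint P by (rule product.strong_packing_Un)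
  have "card (row_ladders H c d u \<F> \<union> column_ladders G x y v \<K>) =
      card (row_ladders H c d u \<F>) + card (column_ladders G x y v \<K>)"
    using rows(1) columns(1) disjoint P by (rule product.strong_packing_Un)
  then show ?card
    by (simp only: rows(2) columns(2))
qed

lemma arc_disjoint_corner_ladders:
  assumes \<F>: "strong_packing G S \<F>" and F\<^sub>0: "F\<^sub>0 \<in> \<F>"
    and \<K>: "strong_packing H T \<K>" and K\<^sub>0: "K\<^sub>0 \<in> \<K>"
    and u: "distinct_representatives (\<F> - {F\<^sub>0}) {x, y} u"
    and v: "distinct_representatives (\<K> - {K\<^sub>0}) {c, d} v"
    and L: "L \<in> row_ladders H c d u (\<F> - {F\<^sub>0}) \<union> column_ladders G x y v (\<K> - {K\<^sub>0})"
  shows "arc_disjoint (corner c y F\<^sub>0 K\<^sub>0) L"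
proof -
  have \<F>_arcs: "parcs F \<subseteq> parcs G" if "F \<in> \<F>" for F
    using strong_subgraphD(3)[OF strong_packing_strong_subgraph[OF \<F> that]] .
  consider (row) F where "F \<in> \<F>" "F \<noteq> F\<^sub>0" "L = row_ladder H c d (u F) F"
    | (column) K where "K \<in> \<K>" "K \<noteq> K\<^sub>0" "L = column_ladder G x y (v K) K"
    using L by blast
  then show ?thesis
  proof cases
    case row
    then have "arc_disjoint F\<^sub>0 F" "y \<noteq> u F"
      using strong_packing_arc_disjoint[OF \<F> F\<^sub>0] u by (auto simp: distinct_representatives_def)
    then show ?thesis
      unfolding row(3) using \<F>_arcs[OF F\<^sub>0] \<F>_arcs[OF row(1)]
      by (intro arc_disjoint_corner_row_ladder)
  next
    case column
    then have "arc_disjoint K\<^sub>0 K" "c \<noteq> v K"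
      using strong_packing_arc_disjoint[OF \<K> K\<^sub>0] v by (auto simp: distinct_representatives_def)
    then show ?thesis
      unfolding column(3) using \<F>_arcs[OF F\<^sub>0] by (intro arc_disjoint_corner_column_ladder)
  qed
qed

lemma lambda_S_add_le_lambda_S_product:
  assumes S: "S \<subseteq> pverts G" "x \<in> S" "y \<in> S" "S \<noteq> {x}"
    and T: "T \<subseteq> pverts H" "c \<in> T" "d \<in> T" "T \<noteq> {c}"
    and neq: "(x, c) \<noteq> (y, d)"
  shows "lambda_S G S + lambda_S H T \<le> lambda_S (G \<box> H) {(x, c), (y, d)} + 1"
proof -
  define P where "P = {(x, c), (y, d)}"
  obtain \<F> where \<F>: "strong_packing G S \<F>" "card \<F> = lambda_S G S"
    by (rule G.obtain_maximum_strong_packing)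
  obtain \<K> where \<K>: "strong_packing H T \<K>" "card \<K> = lambda_S H T"
    by (rule H.obtain_maximum_strong_packing)
  have "\<F> \<noteq> {}" "\<K> \<noteq> {}"
    using G.lambda_S_pos[OF S(1)] \<F>(2) H.lambda_S_pos[OF T(1)] \<K>(2) by auto
  obtain F\<^sub>0 u where F\<^sub>0: "F\<^sub>0 \<in> \<F>" and u: "distinct_representatives (\<F> - {F\<^sub>0}) {x, y} u"
    by (rule G.obtain_distinct_representatives_avoiding[OF \<F>(1) \<open>\<F> \<noteq> {}\<close> S(2,4)])
  obtain K\<^sub>0 v where K\<^sub>0: "K\<^sub>0 \<in> \<K>" and v: "distinct_representatives (\<K> - {K\<^sub>0}) {c, d} v"
    by (rule H.obtain_distinct_representatives_avoiding[OF \<K>(1) \<open>\<K> \<noteq> {}\<close> T(2,4)])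
  define \<L> where "\<L> = row_ladders H c d u (\<F> - {F\<^sub>0}) \<union> column_ladders G x y v (\<K> - {K\<^sub>0})"
  have \<L>: "strong_packing (G \<box> H) P \<L>" "card \<L> = card (\<F> - {F\<^sub>0}) + card (\<K> - {K\<^sub>0})"
    unfolding \<L>_def P_def
    using ladders_strong_packing[OF strong_packing_subset[OF \<F>(1)] S(1-3)
        strong_packing_subset[OF \<K>(1)] T(1-3) neq u v] by auto
  have corner: "strong_subgraph (G \<box> H) P (corner c y F\<^sub>0 K\<^sub>0)"
    using strong_packing_strong_subgraph[OF \<F>(1) F\<^sub>0] strong_packing_strong_subgraph[OF \<K>(1) K\<^sub>0]
      S(3) T(2)
    by (rule strong_subgraph_antimono[OF strong_subgraph_corner]) (use S T in \<open>auto simp: P_def\<close>)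
  have disjoint: "arc_disjoint (corner c y F\<^sub>0 K\<^sub>0) L" if "L \<in> \<L>" for L
    using arc_disjoint_corner_ladders[OF \<F>(1) F\<^sub>0 \<K>(1) K\<^sub>0 u v] that by (simp add: \<L>_def)
  have P: "(x, c) \<in> P" "P \<noteq> {(x, c)}"
    using neq by (auto simp: P_def)
  have "Suc (card \<L>) \<le> lambda_S (G \<box> H) P"
    using product.strong_packing_insert[OF \<L>(1) corner disjoint P]
      product.card_strong_packing_le_lambda_S by metis
  then show ?thesis
    using \<L>(2) \<F>(2) \<K>(2) F\<^sub>0 K\<^sub>0 by (simp add: P_def)
qed

lemma lambda_2_add_le_lambda_S_product:
  assumes "2 \<le> card (pverts G)" "2 \<le> card (pverts H)"
    and "p \<in> pverts (G \<box> H)" "q \<in> pverts (G \<box> H)" "p \<noteq> q"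
  shows "lambda_2 G + lambda_2 H \<le> lambda_S (G \<box> H) {p, q} + 1"
proof -
  obtain x c y d where pq: "p = (x, c)" "q = (y, d)"
    by (metis surj_pair)
  obtain S where S: "{x, y} \<subseteq> S" "S \<subseteq> pverts G" "card S = 2"
    using G.obtain_pair_containing[OF assms(1), of x y] assms(3,4) pq by auto
  obtain T where T: "{c, d} \<subseteq> T" "T \<subseteq> pverts H" "card T = 2"
    using H.obtain_pair_containing[OF assms(2), of c d] assms(3,4) pq by auto
  have "S \<noteq> {x}" "T \<noteq> {c}"
    using S(3) T(3) by auto
  then have "lambda_S G S + lambda_S H T \<le> lambda_S (G \<box> H) {p, q} + 1"
    unfolding pq using S T \<open>p \<noteq> q\<close>
    by (intro lambda_S_add_le_lambda_S_product) (auto simp: pq)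
  then show ?thesis
    using G.lambda_2_le_lambda_S[OF S(2,3)] H.lambda_2_le_lambda_S[OF T(2,3)] by linarith
qed

end

theorem theorem4p2:
  fixes G :: "'a pair_pre_digraph" and H :: "'b pair_pre_digraph"
  assumes "pair_digraph G" and "pair_digraph H"
    and "strongly_connected (with_proj G)" and "strongly_connected (with_proj H)"
    and "2 \<le> card (pverts G)" and "2 \<le> card (pverts H)"
  shows "int (lambda_2 (G \<box> H)) \<ge> int (lambda_2 G) + int (lambda_2 H) - 1"
proof -
  interpret strong_digraph_pair G H
    using assms(1-4)
    by (intro strong_digraph_pair.intro strong_digraph.intro strong_digraph_axioms.intro)
  have "2 \<le> card (pverts (G \<box> H))"
    using mult_le_mono[OF assms(5,6)] by simp
  then obtain p q where "p \<in> pverts (G \<box> H)" "q \<in> pverts (G \<box> H)" "p \<noteq> q"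
    and "lambda_2 (G \<box> H) = lambda_S (G \<box> H) {p, q}"
    by (rule product.obtain_pair_attaining_lambda_2)
  then have "lambda_2 G + lambda_2 H \<le> lambda_2 (G \<box> H) + 1"
    using lambda_2_add_le_lambda_S_product[OF assms(5,6)] by simp
  then show ?thesis
    by linarith
qed

end
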